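(* Let $W=X\times Y$, $f:W\to\mathbb{R}$, the norm $\|\cdot\|$, the localized duality gap $\Delta_r$, the optimal set $W^*$ (nonempty), the iterative algorithm with iterates $w^t(v)$, and the adaptive restart scheme be as defined in the context. Let $\beta\in(0,1)$ and let $\phi:\mathbb{R}^+\to\mathbb{R}^+$ be strictly increasing, log-concave and unbounded from above. Suppose the following four conditions hold. (i) For all $w\in W$, $r_a\in(0,\infty)$ and $r_b\in[0,\infty)$: $\Delta_{r_b}(w)\le \max\{1,r_b/r_a\}\,\Delta_{r_a}(w)$. (ii) There is a constant $C\in(0,\infty)$ such that for all $v\in W$ and $t\in\mathbb{N}$, with $r=\|w^t(v)-v\|$: $\Delta_{\beta r}(w^t(v))\le \dfrac{C(1+\beta)^2r^2}{\phi(t)}$. (iii) There is a monotone decreasing (not necessarily strictly) function $Q:\mathbb{R}\to\mathbb{R}^+$ such that $\|w^t(v)-w^*\|\le Q(t)\|v-w^*\|$ for all $w^*\in W^*$, $t\in\mathbb{N}$, $v\in W$. (iv) There is a constant $\theta\in(0,\infty)$ such that for all $w\in W$, with $r^*=\|W^*-w\|$: $\theta (r^* )^2\le\Delta_{r^*}(w)$. Let $\hat\kappa:=C/\theta$ and let $t^*\in[2,\infty)$ (with $t^*-2$ in the domain of $\phi$) be any number satisfying $$\frac{\phi(t^*-2)}{(1+Q(t^*-2))^2}\ \ge\ \frac{(1+\beta)^2}{\beta^2}\,\hat\kappa .$$ Let $\epsilon\in(0,1)$, $v_0\in W$, and let $\{v_i\}_{i\ge0}$, $\{\tau_i\}_{i\ge1}$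 be generated by the adaptive restart scheme (with parameters $\beta,\phi$) started from $v_0$, with arbitrary initial epoch length $\tau_1\in\mathbb{N}$. Then for $$n=\left\lceil \log_{1/\beta}\!\left(\frac{1+Q(\tau_1)}{\epsilon}\max\left\{1,\frac{\phi(t^* )}{\phi(\tau_1)}\right\}\right)\right\rceil$$ one has $\|W^*-v_n\|\le\epsilon\,\|W^*-v_0\|$ and $\sum_{i=1}^n\tau_i\le t^*n+2(\tau_1-t^* )^+$.
   Context: $\mathbb{N}=\{1,2,\dots\}$; $\mathbb{R}^+$ is the set of positive reals; $(a)^+=\max\{a,0\}$. $X\subseteq\mathbb{R}^{p}$ and $Y\subseteq\mathbb{R}^{m}$ are closed convex sets, $W=X\times Y$, and $w\in W$ is written $w=(w_x,w_y)$. $\|\cdot\|$ is an arbitrary norm, $B_r(w)=\{\hat w\in W:\|w-\hat w\|\le r\}$, and for a set $\hat W$, $\|\hat W-w\|=\inf_{\hat w\in\hat W}\|\hat w-w\|$. For $f:W\to\mathbb{R}$ the localized duality gap is $$\Delta_r(w)=\sup_{(x,y)\in B_r(w)} f(w_x,y)-f(x,w_y),$$ and $W^*=\{w\in W:\Delta_r(w)=0\ \ \forall r\in\mathbb{R}^+\}$. (For pure minimization, $W=X$ and $\Delta_r(w)=f(w)-\inf_{\tilde w\in B_r(w)}f(\tilde w)$.) Iterative algorithm: a deterministic initialization map sends $v\in W$ to an output and internal state $(w^0,s^0)$, and a deterministic step map sends $(w^{t-1},s^{t-1})$ to $(w^t,s^t)$ for $t=1,2,\dots$. The resulting outputs for start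 $v$ are denoted $w^t(v)\in W$, $t\in\mathbb{N}$. Adaptive restart scheme with parameters $\beta,\phi$: given $v_0\in W$, for epochs $i=1,2,\dots$ run the iterative algorithm from $v_{i-1}$, producing $w_i^t=w^t(v_{i-1})$, $t=1,2,\dots$. Epoch $1$ is stopped after an arbitrarily chosen number $\tau_1\in\mathbb{N}$ of steps. For $i>1$, epoch $i$ is stopped at the first $t\in\mathbb{N}$ (called $\tau_i$) for which $$\frac{\|w_i^t-v_{i-1}\|}{\phi(t)}\le\beta\,\frac{\|v_{i-1}-v_{i-2}\|}{\phi(\tau_{i-1})}.$$ Set $v_i=w_i^{\tau_i}$.
   Formalization: Added hypothesis: whenever v_i = v_{i-1} for some i ≥ 1, the point v_{i-1} lies in W*. Without it the claim fails: if w^t(v) = v at a non-optimal v, condition (ii) is vacuous there and the scheme can stay at v forever. *)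

theory Defs
  imports "HOL-Analysis.Analysis"
begin

definition is_norm :: "('a::real_vector \<Rightarrow> real) \<Rightarrow> bool" where
  "is_norm N \<longleftrightarrow>
     (\<forall>x. N x = 0 \<longleftrightarrow> x = 0) \<and>
     (\<forall>c x. N (c *\<^sub>R x) = \<bar>c\<bar> * N x) \<and>
     (\<forall>x y. N (x + y) \<le> N x + N y)"

definition ball_in :: "('a::real_vector \<Rightarrow> real) \<Rightarrow> 'a set \<Rightarrow> real \<Rightarrow> 'a \<Rightarrow> 'a set" where
  "ball_in N W r w = {u \<in> W. N (w - u) \<le> r}"

definition set_distance :: "('a::real_vector \<Rightarrow> real) \<Rightarrow> 'a set \<Rightarrow> 'a \<Rightarrow> real" where
  "set_distance N A w = (INF a\<in>A. N (a - w))"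

text \<open>The supremum is taken in the extended reals, because \<open>f\<close> need not be bounded on the ball.
  Minimization of a function of \<open>x\<close> alone is the case where \<open>Y\<close> is a singleton.\<close>

definition duality_gap ::
  "('a::real_vector \<times> 'b::real_vector \<Rightarrow> real) \<Rightarrow> 'a set \<Rightarrow> 'b set \<Rightarrow>
   ('a \<times> 'b \<Rightarrow> real) \<Rightarrow> real \<Rightarrow> 'a \<times> 'b \<Rightarrow> ereal" where
  "duality_gap N X Y f r w =
     (SUP (x, y) \<in> ball_in N (X \<times> Y) r w. ereal (f (fst w, y) - f (x, snd w)))"

definition optimal_set ::
  "('a::real_vector \<times> 'b::real_vector \<Rightarrow> real) \<Rightarrow> 'a set \<Rightarrow> 'b set \<Rightarrow>
   ('a \<times> 'b \<Rightarrow> real) \<Rightarrow> ('a \<times> 'b) set" where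
  "optimal_set N X Y f = {w \<in> X \<times> Y. \<forall>r>0. duality_gap N X Y f r w = 0}"

definition iterate :: "('w \<Rightarrow> 'w \<times> 's) \<Rightarrow> ('w \<times> 's \<Rightarrow> 'w \<times> 's) \<Rightarrow> nat \<Rightarrow> 'w \<Rightarrow> 'w" where
  "iterate init step t v = fst ((step ^^ t) (init v))"

text \<open>The test, after \<open>t\<close> steps of an epoch started at \<open>v\<close>, whether to end that epoch, where the
  preceding epoch started at \<open>u\<close> and had length \<open>l\<close>; \<open>w t v\<close> is the \<open>t\<close>-th iterate from \<open>v\<close>.\<close>

definition restart_test ::
  "('w::real_vector \<Rightarrow> real) \<Rightarrow> real \<Rightarrow> (real \<Rightarrow> real) \<Rightarrow> (nat \<Rightarrow> 'w \<Rightarrow> 'w) \<Rightarrow>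
   'w \<Rightarrow> nat \<Rightarrow> 'w \<Rightarrow> nat \<Rightarrow> bool" where
  "restart_test N \<beta> \<phi> w u l v t \<longleftrightarrow>
     N (w t v - v) / \<phi> (real t) \<le> \<beta> * (N (v - u) / \<phi> (real l))"

text \<open>\<open>v i\<close> is the output of epoch \<open>i\<close> and \<open>\<tau> i\<close> its length, for \<open>i \<ge> 1\<close>; the value \<open>\<tau> 0\<close> is
  irrelevant. That some \<open>t\<close> passes the test is not required here: where none does, \<open>LEAST\<close>
  returns an unspecified number.\<close>

definition adaptive_restart ::
  "('w::real_vector \<Rightarrow> real) \<Rightarrow> real \<Rightarrow> (real \<Rightarrow> real) \<Rightarrow> (nat \<Rightarrow> 'w \<Rightarrow> 'w) \<Rightarrow>
   'w \<Rightarrow> (nat \<Rightarrow> 'w) \<Rightarrow> (nat \<Rightarrow> nat) \<Rightarrow> bool" where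
  "adaptive_restart N \<beta> \<phi> w v0 v \<tau> \<longleftrightarrow>
     v 0 = v0 \<and> \<tau> 1 \<ge> 1 \<and>
     (\<forall>i\<ge>2. \<tau> i = (LEAST t. t \<ge> 1 \<and>
        restart_test N \<beta> \<phi> w (v (i - 2)) (\<tau> (i - 1)) (v (i - 1)) t)) \<and>
     (\<forall>i\<ge>1. v i = w (\<tau> i) (v (i - 1)))"

end

theory Submission
  imports Defs
begin

text \<open>
  Let \<open>r = \<parallel>w\<^sup>t(u) - u\<parallel>\<close> and \<open>d\<close> be the distance of \<open>w\<^sup>t(u)\<close> to the optimal set. Conditions (i), (ii)
  and (iv) give \<open>\<theta> d\<^sup>2 \<le> max {1, d/(\<beta>r)} C(1+\<beta>)\<^sup>2 r\<^sup>2/\<phi>(t)\<close>: either \<open>d\<close> is of order \<open>r/\<phi>(t)\<close>, or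
  \<open>d \<le> \<beta>r\<close> and \<open>d\<close> is of order \<open>r/\<surd>\<phi>(t)\<close>. By (iii) the next epoch moves by at most \<open>(1 + Q) d\<close>. In
  the first case the restart test therefore passes once \<open>t \<ge> t\<^sup>* - 2\<close>; in the second case it passes
  as soon as also \<open>\<phi>(t)\<^sup>2 \<ge> \<phi>(t\<^sup>* - 2) \<phi>(l)\<close> for the previous length \<open>l\<close>, which by log-concavity
  follows from \<open>t \<ge> (t\<^sup>* - 2 + l)/2\<close>. So the excess of the epoch length over \<open>t\<^sup>*\<close> halves in every
  epoch, while \<open>r/\<phi>(t)\<close> shrinks by the factor \<open>\<beta>\<close>.
\<close>

section \<open>Norms and the distance to a set\<close>

lemma is_norm_minus_commute: "is_norm N \<Longrightarrow> N (x - y) = N (y - x)"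
proof -
  assume N: "is_norm N"
  have "N ((-1) *\<^sub>R (y - x)) = N (y - x)"
    using N unfolding is_norm_def by (metis abs_minus_cancel abs_one mult_1)
  then show ?thesis by simp
qed

lemma is_norm_zero: "is_norm N \<Longrightarrow> N 0 = 0"
  by (simp add: is_norm_def)

lemma is_norm_nonneg: "is_norm N \<Longrightarrow> 0 \<le> N x"
proof -
  assume N: "is_norm N"
  have "N (x + - x) \<le> N x + N (- x)" using N unfolding is_norm_def by blast
  moreover have "N (- x) = N x" using is_norm_minus_commute[OF N, of 0 x] by simp
  ultimately show ?thesis using is_norm_zero[OF N] by simp
qed

lemma is_norm_pos: "is_norm N \<Longrightarrow> x \<noteq> y \<Longrightarrow> 0 < N (x - y)"
  by (metis is_norm_def is_norm_nonneg less_eq_real_def right_minus_eq)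

lemma is_norm_triangle: "is_norm N \<Longrightarrow> N (x - y) \<le> N (x - z) + N (y - z)"
proof -
  assume N: "is_norm N"
  have "N ((x - z) + (z - y)) \<le> N (x - z) + N (z - y)" using N unfolding is_norm_def by blast
  then show ?thesis by (simp add: is_norm_minus_commute[OF N, of z y])
qed

lemma set_distance_nonneg: "is_norm N \<Longrightarrow> A \<noteq> {} \<Longrightarrow> 0 \<le> set_distance N A u"
  unfolding set_distance_def by (intro cINF_greatest) (auto simp: is_norm_nonneg)

lemma set_distance_le: "is_norm N \<Longrightarrow> a \<in> A \<Longrightarrow> set_distance N A u \<le> N (a - u)"
  unfolding set_distance_def
  by (intro cINF_lower) (auto simp: is_norm_nonneg intro: bdd_belowI2[where m = 0])

lemma set_distance_ge:
  "A \<noteq> {} \<Longrightarrow> (\<And>a. a \<in> A \<Longrightarrow> c \<le> N (a - u)) \<Longrightarrow> c \<le> set_distance N A u"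
  unfolding set_distance_def by (rule cINF_greatest)

lemma set_distance_mem: "is_norm N \<Longrightarrow> u \<in> A \<Longrightarrow> set_distance N A u = 0"
  using set_distance_le[of N u A u] set_distance_nonneg[of N A u] is_norm_zero[of N] by auto

section \<open>Midpoint log-concavity\<close>

text \<open>Concavity of \<open>ln \<phi>\<close> at weight 1/2 bounds the geometric mean of the end
  values by the value at the midpoint; monotonicity then passes up to \<open>t\<close>. It is
  applied with \<open>s = tstar - 2\<close> and \<open>l\<close> the length of the previous
  epoch.\<close>

lemma log_concave_midpoint:
  fixes \<phi> :: "real \<Rightarrow> real"
  assumes pos: "\<And>s. s > 0 \<Longrightarrow> \<phi> s > 0" and "mono_on {0<..} \<phi>"
    and conc: "concave_on {0<..} (\<lambda>s. ln (\<phi> s))"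
    and "s > 0" "l > 0" "(s + l) / 2 \<le> t"
  shows "\<phi> s * \<phi> l \<le> (\<phi> t)\<^sup>2"
proof -
  define m where "m = (s + l) / 2"
  have m: "m > 0" "m \<le> t" using assms(4-6) by (simp_all add: m_def)
  have p: "\<phi> s > 0" "\<phi> l > 0" "\<phi> m > 0" using pos assms(4,5) m by blast+
  have conc2: "(1 - 1/2) * ln (\<phi> s) + (1/2) * ln (\<phi> l) \<le> ln (\<phi> ((1 - 1/2) *\<^sub>R s + (1/2) *\<^sub>R l))"
    by (rule concave_onD[OF conc]) (use assms in auto)
  have mid: "(1 - 1/2) *\<^sub>R s + (1/2) *\<^sub>R l = m" by (simp add: m_def field_simps)
  have "ln (\<phi> s) + ln (\<phi> l) \<le> 2 * ln (\<phi> m)" using conc2 unfolding mid by simp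
  then have "ln (\<phi> s * \<phi> l) \<le> ln ((\<phi> m)\<^sup>2)"
    using p by (simp add: ln_mult_pos ln_realpow)
  then have "\<phi> s * \<phi> l \<le> (\<phi> m)\<^sup>2"
    using p by (subst (asm) ln_le_cancel_iff) auto
  also have "\<dots> \<le> (\<phi> t)\<^sup>2"
    using m p by (intro power_mono mono_onD[OF assms(2)]) auto
  finally show ?thesis .
qed

section \<open>The scheme for an abstract gap function\<close>

text \<open>The gap \<open>\<Delta>\<close> and the set \<open>S\<close> are abstract and tied
  together only by conditions (i) to (iv). The assumption \<open>no_stall\<close> handles an epoch
  of zero movement: \<open>gap_iter\<close> then speaks of radius 0, which is not an admissible
  \<open>ra\<close> in \<open>gap_scale\<close>, so the conditions yield no bound on the
  distance.\<close>

locale restart_scheme =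
  fixes N :: "'a::real_vector \<Rightarrow> real" and W S :: "'a set" and \<Delta> :: "real \<Rightarrow> 'a \<Rightarrow> ereal"
    and w :: "nat \<Rightarrow> 'a \<Rightarrow> 'a" and \<phi> Q :: "real \<Rightarrow> real" and \<beta> C \<theta> tstar :: real
    and v :: "nat \<Rightarrow> 'a" and \<tau> :: "nat \<Rightarrow> nat"
  assumes norm: "is_norm N"
    and nonempty: "S \<noteq> {}"
    and closed_iter: "\<And>u t. u \<in> W \<Longrightarrow> t \<ge> 1 \<Longrightarrow> w t u \<in> W"
    and beta: "0 < \<beta>" "\<beta> < 1"
    and phi_pos: "\<And>s. s > 0 \<Longrightarrow> \<phi> s > 0"
    and phi_mono: "mono_on {0<..} \<phi>"
    and phi_concave: "concave_on {0<..} (\<lambda>s. ln (\<phi> s))"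
    and gap_scale: "\<And>u ra rb. u \<in> W \<Longrightarrow> ra > 0 \<Longrightarrow> rb \<ge> 0 \<Longrightarrow>
      \<Delta> rb u \<le> ereal (max 1 (rb / ra)) * \<Delta> ra u"
    and C_pos: "C > 0"
    and gap_iter: "\<And>u t. u \<in> W \<Longrightarrow> t \<ge> 1 \<Longrightarrow>
      \<Delta> (\<beta> * N (w t u - u)) (w t u) \<le> ereal (C * (1 + \<beta>)\<^sup>2 * (N (w t u - u))\<^sup>2 / \<phi> (real t))"
    and Q_antimono: "antimono Q"
    and Q_pos: "\<And>s. Q s > 0"
    and iter_bound: "\<And>u t z. u \<in> W \<Longrightarrow> t \<ge> 1 \<Longrightarrow> z \<in> S \<Longrightarrow>
      N (w t u - z) \<le> Q (real t) * N (u - z)"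
    and theta_pos: "\<theta> > 0"
    and growth: "\<And>u. u \<in> W \<Longrightarrow>
      ereal (\<theta> * (set_distance N S u)\<^sup>2) \<le> \<Delta> (set_distance N S u) u"
    and tstar: "tstar > 2"
    and tstar_large: "(1 + \<beta>)\<^sup>2 / \<beta>\<^sup>2 * (C / \<theta>) \<le> \<phi> (tstar - 2) / (1 + Q (tstar - 2))\<^sup>2"
    and v0: "v 0 \<in> W"
    and scheme: "adaptive_restart N \<beta> \<phi> w (v 0) v \<tau>"
    and no_stall: "\<And>i. i \<ge> 1 \<Longrightarrow> v i = v (i - 1) \<Longrightarrow> v (i - 1) \<in> S"
begin

abbreviation dist_opt :: "'a \<Rightarrow> real" where "dist_opt \<equiv> set_distance N S"

text \<open>With this constant, condition (ii) has the numerator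
  \<open>\<theta> * \<beta>\<^sup>2 * K * r\<^sup>2\<close>, and \<open>tstar_large\<close> says
  that \<open>\<phi> (tstar - 2)\<close> dominates
  \<open>K * (1 + Q (tstar - 2))\<^sup>2\<close>.\<close>

definition K :: real where "K = (1 + \<beta>)\<^sup>2 / \<beta>\<^sup>2 * (C / \<theta>)"

lemma K_pos: "K > 0"
  using beta C_pos theta_pos by (simp add: K_def)

section \<open>Movement and error of a single epoch\<close>

text \<open>The triangle inequality through an optimal \<open>z\<close> gives the bound with
  \<open>N (u - z)\<close>. As no nearest \<open>z\<close> has to exist, the factor is divided out
  and the infimum over \<open>z\<close> taken.\<close>

lemma step_bound:
  assumes "u \<in> W" "t \<ge> 1"
  shows "N (w t u - u) \<le> (1 + Q (real t)) * dist_opt u"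
proof -
  have Q: "1 + Q (real t) > 0" using Q_pos[of "real t"] by simp
  have "N (w t u - u) / (1 + Q (real t)) \<le> dist_opt u"
  proof (rule set_distance_ge[OF nonempty])
    fix z assume z: "z \<in> S"
    have "N (w t u - u) \<le> N (w t u - z) + N (u - z)" by (rule is_norm_triangle[OF norm])
    also have "\<dots> \<le> (1 + Q (real t)) * N (u - z)"
      using iter_bound[OF assms z] by (simp add: algebra_simps)
    finally show "N (w t u - u) / (1 + Q (real t)) \<le> N (z - u)"
      using Q by (simp add: is_norm_minus_commute[OF norm, of z u] divide_le_eq mult.commute)
  qed
  then show ?thesis using Q by (simp add: divide_le_eq mult.commute)
qed

text \<open>Growth bounds the gap at radius \<open>d\<close> from below, and (ii) bounds the gap at
  radius \<open>\<beta> * r\<close> from above; (i) links the two radii. The two alternatives are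
  the two values of the maximum in (i).\<close>

lemma error_bound:
  assumes u: "u \<in> W" and t: "t \<ge> 1" and stall: "w t u = u \<Longrightarrow> u \<in> S"
  defines "r \<equiv> N (w t u - u)" and "d \<equiv> dist_opt (w t u)"
  shows "d \<le> \<beta> * K * r / \<phi> (real t) \<or>
    d \<le> \<beta> * r \<and> d\<^sup>2 \<le> \<beta>\<^sup>2 * K * r\<^sup>2 / \<phi> (real t)"
proof (cases "w t u = u")
  case True
  then show ?thesis
    using stall set_distance_mem[OF norm, of u S] is_norm_zero[OF norm]
    by (simp add: r_def d_def)
next
  case False
  then have r: "r > 0" unfolding r_def by (rule is_norm_pos[OF norm])
  have d: "d \<ge> 0" unfolding d_def by (rule set_distance_nonneg[OF norm nonempty])
  have p: "\<phi> (real t) > 0" using t by (intro phi_pos) simp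
  have br: "\<beta> * r > 0" using r beta by simp
  have vW: "w t u \<in> W" using closed_iter[OF u t] .
  let ?m = "max 1 (d / (\<beta> * r))" and ?B = "C * (1 + \<beta>)\<^sup>2 * r\<^sup>2 / \<phi> (real t)"
  have "ereal (\<theta> * d\<^sup>2) \<le> \<Delta> d (w t u)" unfolding d_def by (rule growth[OF vW])
  also have "\<dots> \<le> ereal ?m * \<Delta> (\<beta> * r) (w t u)" by (rule gap_scale[OF vW br d])
  also have "\<dots> \<le> ereal ?m * ereal ?B"
    using gap_iter[OF u t] by (intro ereal_mult_left_mono) (auto simp: r_def le_max_iff_disj)
  finally have main: "\<theta> * d\<^sup>2 \<le> ?m * ?B"
    by (simp only: times_ereal.simps ereal_less_eq)
  have B: "?B = \<theta> * (\<beta>\<^sup>2 * K * r\<^sup>2 / \<phi> (real t))"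
    using beta theta_pos by (simp add: K_def)
  have main': "d\<^sup>2 \<le> ?m * (\<beta>\<^sup>2 * K * r\<^sup>2 / \<phi> (real t))"
  proof -
    have "\<theta> * d\<^sup>2 \<le> \<theta> * (?m * (\<beta>\<^sup>2 * K * r\<^sup>2 / \<phi> (real t)))"
      using main unfolding B by (simp only: mult.left_commute)
    then show ?thesis by (rule mult_left_le_imp_le[OF _ theta_pos])
  qed
  show ?thesis
  proof (cases "d \<le> \<beta> * r")
    case True
    then have "?m = 1" using br by (simp add: max_def divide_le_eq)
    then show ?thesis using main' True by simp
  next
    case False
    then have d0: "d > 0" using br by simp
    have m: "?m = d / (\<beta> * r)" using False br by (simp add: max_def divide_le_eq)
    \<comment> \<open>Here the factor from (i) is \<open>d / (\<beta> * r)\<close>, so one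
      \<open>d\<close> cancels and the bound becomes linear in \<open>r\<close>.\<close>
    have "d * d \<le> d / (\<beta> * r) * (\<beta>\<^sup>2 * K * r\<^sup>2 / \<phi> (real t))"
      using main' unfolding m by (simp only: power2_eq_square)
    also have "\<dots> = d * (\<beta> * K * r / \<phi> (real t))"
    proof -
      have "x / (b * y) * (b\<^sup>2 * k * y\<^sup>2 / p) = x * (b * k * y / p)"
        if "b > 0" "y > 0" for x b y k p :: real
        using that by (cases "p = 0") (simp_all add: field_simps power2_eq_square)
      then show ?thesis using beta r by blast
    qed
    finally have "d \<le> \<beta> * K * r / \<phi> (real t)"
      by (rule mult_left_le_imp_le[OF _ d0])
    then show ?thesis ..
  qed
qed

text \<open>\<open>Q\<close> decreases, so the condition at \<open>tstar - 2\<close> persists for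
  later \<open>t\<close>. The right side of the first bound stays at \<open>tstar - 2\<close>
  because the midpoint argument needs \<open>\<phi>\<close> there, not at \<open>t\<close>.\<close>

lemma tstar_largeD:
  assumes "real t \<ge> tstar - 2"
  shows "K * (1 + Q (real t))\<^sup>2 \<le> \<phi> (tstar - 2)" and "\<phi> (tstar - 2) \<le> \<phi> (real t)"
proof -
  have "(1 + Q (real t))\<^sup>2 \<le> (1 + Q (tstar - 2))\<^sup>2"
    using antimonoD[OF Q_antimono assms] Q_pos[of "real t"] by (intro power_mono) auto
  then have "K * (1 + Q (real t))\<^sup>2 \<le> K * (1 + Q (tstar - 2))\<^sup>2"
    using K_pos by (intro mult_left_mono) auto
  also have "\<dots> \<le> \<phi> (tstar - 2)"
    using tstar_large[folded K_def] Q_pos[of "tstar - 2"]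
    by (subst (asm) pos_le_divide_eq) (auto intro!: zero_less_power)
  finally show "K * (1 + Q (real t))\<^sup>2 \<le> \<phi> (tstar - 2)" .
  show "\<phi> (tstar - 2) \<le> \<phi> (real t)"
    using tstar assms by (intro mono_onD[OF phi_mono]) auto
qed

section \<open>When the restart test succeeds\<close>

text \<open>The new epoch moves by at most \<open>q * d\<close>, so clearing denominators leaves
  \<open>q * d * \<phi> (real l) \<le> \<beta> * r * \<phi> (real t)\<close>, which is checked in
  both alternatives of \<open>error_bound\<close>.\<close>

lemma restart_test_passes:
  assumes u: "u \<in> W" and l: "l \<ge> 1" and stall: "w l u = u \<Longrightarrow> u \<in> S"
    and t: "real t \<ge> tstar - 2" "real t \<ge> (tstar - 2 + real l) / 2"
  shows "restart_test N \<beta> \<phi> w u l (w l u) t"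
proof -
  have t1: "t \<ge> 1" using t tstar by (cases t) auto
  define r d q where "r = N (w l u - u)" and "d = dist_opt (w l u)" and "q = 1 + Q (real t)"
  have r: "r \<ge> 0" unfolding r_def by (rule is_norm_nonneg[OF norm])
  have d: "d \<ge> 0" unfolding d_def by (rule set_distance_nonneg[OF norm nonempty])
  have q: "q \<ge> 1" using Q_pos[of "real t"] by (simp add: q_def)
  have pt: "\<phi> (real t) > 0" using t1 by (intro phi_pos) simp
  have pl: "\<phi> (real l) > 0" using l by (intro phi_pos) simp
  note large = tstar_largeD[OF t(1), folded q_def]
  have "q * d * \<phi> (real l) \<le> \<beta> * r * \<phi> (real t)"
    using error_bound[OF u l stall, folded r_def d_def]
  proof
    assume "d \<le> \<beta> * K * r / \<phi> (real l)"
    then have "d * \<phi> (real l) \<le> \<beta> * K * r" by (simp only: pos_le_divide_eq[OF pl])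
    then have "q * (d * \<phi> (real l)) \<le> q * (\<beta> * K * r)" using q by (intro mult_left_mono) auto
    also have "\<dots> = \<beta> * r * (K * q)" by (simp only: mult_ac)
    \<comment> \<open>Since \<open>q \<ge> 1\<close>, the factor \<open>q\<close> may be replaced by
      its square, the form in which \<open>tstar\<close> was chosen.\<close>
    also have "\<dots> \<le> \<beta> * r * (K * q\<^sup>2)"
      using q r beta K_pos self_le_power[of q 2] by (intro mult_left_mono mult_nonneg_nonneg) auto
    also have "\<dots> \<le> \<beta> * r * \<phi> (real t)"
      using large r beta by (intro mult_left_mono mult_nonneg_nonneg) auto
    finally show ?thesis by (simp only: mult.assoc)
  next
    assume "d \<le> \<beta> * r \<and> d\<^sup>2 \<le> \<beta>\<^sup>2 * K * r\<^sup>2 / \<phi> (real l)"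
    then have "d\<^sup>2 * \<phi> (real l) \<le> \<beta>\<^sup>2 * K * r\<^sup>2" by (simp only: pos_le_divide_eq[OF pl])
    \<comment> \<open>The multiplier turns the left side into the square of
      \<open>q * d * \<phi> (real l)\<close>. The remaining \<open>\<phi> (real l)\<close> on the
      right is absorbed by log-concavity.\<close>
    then have "(q\<^sup>2 * \<phi> (real l)) * (d\<^sup>2 * \<phi> (real l)) \<le> (q\<^sup>2 * \<phi> (real l)) * (\<beta>\<^sup>2 * K * r\<^sup>2)"
      using pl by (intro mult_left_mono) auto
    also have "\<dots> = (\<beta> * r)\<^sup>2 * (K * q\<^sup>2 * \<phi> (real l))"
      by (simp only: power_mult_distrib mult_ac)
    also have "\<dots> \<le> (\<beta> * r)\<^sup>2 * (\<phi> (tstar - 2) * \<phi> (real l))"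
      using large(1) pl by (intro mult_left_mono mult_right_mono) auto
    also have "\<dots> \<le> (\<beta> * r)\<^sup>2 * (\<phi> (real t))\<^sup>2"
      using tstar l t(2)
      by (intro mult_left_mono log_concave_midpoint[OF phi_pos phi_mono phi_concave]) auto
    finally have "(q * d * \<phi> (real l))\<^sup>2 \<le> (\<beta> * r * \<phi> (real t))\<^sup>2"
      by (simp only: power_mult_distrib power2_eq_square mult_ac)
    then show ?thesis
      using r beta pt by (intro power2_le_imp_le[of "q * d * \<phi> (real l)"]) auto
  qed
  moreover have "N (w t (w l u) - w l u) * \<phi> (real l) \<le> q * d * \<phi> (real l)"
    using step_bound[OF closed_iter[OF u l] t1] pl by (simp add: q_def d_def)
  ultimately have "N (w t (w l u) - w l u) * \<phi> (real l) \<le> \<beta> * r * \<phi> (real t)" by simp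
  then show ?thesis
    using pt pl by (simp add: restart_test_def r_def field_simps)
qed

section \<open>Epoch lengths\<close>

lemma v_step: "i \<ge> 1 \<Longrightarrow> v i = w (\<tau> i) (v (i - 1))"
  using scheme by (simp add: adaptive_restart_def)

text \<open>Some \<open>t\<close> passes the test, so \<open>LEAST\<close> is genuine and bounded by
  that \<open>t\<close>. Rounding up costs at most 1; starting from \<open>tstar - 2\<close>, this
  turns the midpoint \<open>(tstar - 2 + real (\<tau> i)) / 2\<close> into
  \<open>(tstar + real (\<tau> i)) / 2\<close>, so the excess over \<open>tstar\<close> is halved
  exactly.\<close>

lemma epoch_step:
  assumes i: "i \<ge> 1" and W: "v (i - 1) \<in> W" and tau: "\<tau> i \<ge> 1"
  defines "P \<equiv> restart_test N \<beta> \<phi> w (v (i - 1)) (\<tau> i) (v i)"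
  shows "\<tau> (Suc i) \<ge> 1" "P (\<tau> (Suc i))"
    "real (\<tau> (Suc i)) \<le> max (tstar - 1) ((tstar + real (\<tau> i)) / 2)"
proof -
  have eq: "\<tau> (Suc i) = (LEAST t. t \<ge> 1 \<and> P t)"
  proof -
    have "\<forall>i\<ge>2. \<tau> i = (LEAST t. t \<ge> 1 \<and>
        restart_test N \<beta> \<phi> w (v (i - 2)) (\<tau> (i - 1)) (v (i - 1)) t)"
      using scheme by (simp add: adaptive_restart_def)
    moreover have "Suc i \<ge> 2" "Suc i - 2 = i - 1" "Suc i - 1 = i" using i by auto
    ultimately show ?thesis unfolding P_def by metis
  qed
  define x where "x = max (tstar - 2) ((tstar - 2 + real (\<tau> i)) / 2)"
  define t where "t = nat \<lceil>x\<rceil>"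
  have x: "x > 0" using tstar by (simp add: x_def)
  have t: "real t \<ge> x" "real t \<le> x + 1" using x by (simp_all add: t_def)
  have "P t"
    unfolding P_def v_step[OF i]
  proof (rule restart_test_passes[OF W tau])
    show "v (i - 1) \<in> S" if "w (\<tau> i) (v (i - 1)) = v (i - 1)"
      using no_stall[OF i] v_step[OF i] that by simp
  qed (use t in \<open>auto simp: x_def\<close>)
  moreover have "t \<ge> 1" using t x by (cases t) auto
  ultimately have Pt: "t \<ge> 1 \<and> P t" by simp
  show "\<tau> (Suc i) \<ge> 1" "P (\<tau> (Suc i))" using LeastI[of "\<lambda>t. t \<ge> 1 \<and> P t", OF Pt] eq by auto
  have "\<tau> (Suc i) \<le> t" using Least_le[of "\<lambda>t. t \<ge> 1 \<and> P t", OF Pt] eq by simp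
  then have "real (\<tau> (Suc i)) \<le> x + 1" using t by linarith
  then show "real (\<tau> (Suc i)) \<le> max (tstar - 1) ((tstar + real (\<tau> i)) / 2)"
    by (simp add: x_def max_def field_simps split: if_splits)
qed

text \<open>Both facts are proved together: an epoch stays in \<open>W\<close> only if its length is
  positive, and the next length is positive only if the current epoch started in
  \<open>W\<close>.\<close>

lemma epoch_valid: "v i \<in> W \<and> \<tau> (Suc i) \<ge> 1"
proof (induction i)
  case 0
  then show ?case using v0 scheme by (simp add: adaptive_restart_def)
next
  case (Suc i)
  then show ?case
    using v_step[of "Suc i"] closed_iter[of "v i" "\<tau> (Suc i)"] epoch_step(1)[of "Suc i"] by simp
qed

lemma restart_test_at_stop:
  "restart_test N \<beta> \<phi> w (v i) (\<tau> (Suc i)) (v (Suc i)) (\<tau> (Suc (Suc i)))"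
  using epoch_step(2)[of "Suc i"] epoch_valid[of i] by simp

lemma excess_bound: "max (real (\<tau> (Suc i)) - tstar) 0 \<le> max (real (\<tau> 1) - tstar) 0 / 2 ^ i"
proof (induction i)
  case (Suc i)
  have "max (real (\<tau> (Suc (Suc i))) - tstar) 0 \<le> max (real (\<tau> (Suc i)) - tstar) 0 / 2"
    using epoch_step(3)[of "Suc i"] epoch_valid[of i] by (simp add: max_def split: if_splits)
  also have "\<dots> \<le> max (real (\<tau> 1) - tstar) 0 / 2 ^ Suc i"
    using divide_right_mono[OF Suc, of 2] by (simp add: mult.commute)
  finally show ?case .
qed simp

text \<open>The excesses are dominated by a geometric series of ratio 1/2, whose sum is at most
  2.\<close>

lemma sum_epochs: "(\<Sum>i = 1..n. real (\<tau> i)) \<le> tstar * real n + 2 * max (real (\<tau> 1) - tstar) 0"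
proof -
  let ?e = "max (real (\<tau> 1) - tstar) 0"
  have geo: "(\<Sum>i<n. (1 / 2 :: real) ^ i) \<le> 2"
    by (simp add: geometric_sum)
  have "(\<Sum>i = 1..n. real (\<tau> i)) = (\<Sum>i<n. real (\<tau> (Suc i)))"
    by (rule sum.reindex_bij_witness[of _ Suc "\<lambda>i. i - 1"]) auto
  also have "\<dots> \<le> (\<Sum>i<n. tstar + ?e * (1 / 2) ^ i)"
  proof (rule sum_mono)
    fix i
    show "real (\<tau> (Suc i)) \<le> tstar + ?e * (1 / 2) ^ i"
      using excess_bound[of i] by (simp add: power_one_over)
  qed
  also have "\<dots> = tstar * real n + ?e * (\<Sum>i<n. (1 / 2) ^ i)"
    by (simp add: sum.distrib sum_distrib_left)
  also have "\<dots> \<le> tstar * real n + ?e * 2"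
    using geo by (intro add_left_mono mult_left_mono) auto
  finally show ?thesis by (simp add: mult.commute)
qed

section \<open>Contraction of the distance\<close>

text \<open>Each passed test contributes one factor \<open>\<beta>\<close>. The first epoch is not
  tested, hence exponent \<open>i\<close> for epoch \<open>Suc i\<close>.\<close>

lemma ratio_bound:
  "N (v (Suc i) - v i) / \<phi> (real (\<tau> (Suc i))) \<le> \<beta> ^ i * (N (v 1 - v 0) / \<phi> (real (\<tau> 1)))"
proof (induction i)
  case (Suc i)
  have "N (v (Suc (Suc i)) - v (Suc i)) / \<phi> (real (\<tau> (Suc (Suc i))))
      \<le> \<beta> * (N (v (Suc i) - v i) / \<phi> (real (\<tau> (Suc i))))"
    using restart_test_at_stop[of i] v_step[of "Suc (Suc i)"] by (simp add: restart_test_def)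
  also have "\<dots> \<le> \<beta> * (\<beta> ^ i * (N (v 1 - v 0) / \<phi> (real (\<tau> 1))))"
    using Suc beta by (intro mult_left_mono) auto
  finally show ?case by simp
qed simp

text \<open>\<open>error_bound\<close> supplies one factor \<open>\<beta>\<close> beyond the
  \<open>k\<close> factors of \<open>ratio_bound\<close>; \<open>step_bound\<close> for the first
  epoch brings in the distance of \<open>v 0\<close>.\<close>

lemma distance_bound:
  "dist_opt (v (Suc k)) \<le> \<beta> ^ Suc k *
    ((1 + Q (real (\<tau> 1))) * max 1 (\<phi> tstar / \<phi> (real (\<tau> 1)))) * dist_opt (v 0)"
proof -
  define p1 where "p1 = \<phi> (real (\<tau> 1))"
  define r p d where "r = N (v (Suc k) - v k)" and "p = \<phi> (real (\<tau> (Suc k)))"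
    and "d = dist_opt (v (Suc k))"
  \<comment> \<open>\<open>M\<close> dominates both \<open>K\<close> and \<open>\<phi>\<close> at
    every epoch length, since no length exceeds both \<open>\<tau> 1\<close> and
    \<open>tstar\<close>. Both alternatives of \<open>error_bound\<close> thus collapse to
    \<open>d \<le> \<beta> * (r / p) * M\<close>.\<close>
  define M where "M = max p1 (\<phi> tstar)"
  have tau: "\<tau> (Suc k) \<ge> 1" "\<tau> 1 \<ge> 1" using epoch_valid[of k] epoch_valid[of 0] by auto
  have p1: "p1 > 0" using tau unfolding p1_def by (intro phi_pos) simp
  have p: "p > 0" using tau unfolding p_def by (intro phi_pos) simp
  have r: "r \<ge> 0" unfolding r_def by (rule is_norm_nonneg[OF norm])
  have pM: "p \<le> M"
  proof -
    have "max (real (\<tau> 1) - tstar) 0 / 2 ^ k \<le> max (real (\<tau> 1) - tstar) 0"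
      using divide_left_mono[of 1 "2 ^ k" "max (real (\<tau> 1) - tstar) 0"] by simp
    then have "real (\<tau> (Suc k)) \<le> max (real (\<tau> 1)) tstar"
      using excess_bound[of k] unfolding max_def by argo
    then have "p \<le> \<phi> (max (real (\<tau> 1)) tstar)"
      using tau tstar unfolding p_def by (intro mono_onD[OF phi_mono]) auto
    then show ?thesis by (auto simp: M_def p1_def max_def split: if_splits)
  qed
  have KM: "K \<le> M"
  proof -
    have "\<phi> (tstar - 2) / (1 + Q (tstar - 2))\<^sup>2 \<le> \<phi> (tstar - 2) / 1"
      using Q_pos[of "tstar - 2"] phi_pos[of "tstar - 2"] tstar
      by (intro divide_left_mono) (auto intro!: one_le_power)
    also have "\<dots> \<le> \<phi> tstar" using tstar by (simp add: mono_onD[OF phi_mono])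
    finally show ?thesis using tstar_large by (simp add: M_def K_def)
  qed
  have "d \<le> \<beta> * K * r / p \<or> d \<le> \<beta> * r \<and> d\<^sup>2 \<le> \<beta>\<^sup>2 * K * r\<^sup>2 / p"
    using error_bound[of "v k" "\<tau> (Suc k)"] no_stall[of "Suc k"] v_step[of "Suc k"]
      epoch_valid[of k] by (simp add: r_def p_def d_def)
  then have "d \<le> \<beta> * (r / p) * M"
  proof
    assume "d \<le> \<beta> * K * r / p"
    also have "\<dots> = \<beta> * (r / p) * K" by (simp only: mult_ac times_divide_eq_right times_divide_eq_left)
    also have "\<dots> \<le> \<beta> * (r / p) * M"
      using KM beta r p by (intro mult_left_mono) auto
    finally show ?thesis .
  next
    assume "d \<le> \<beta> * r \<and> d\<^sup>2 \<le> \<beta>\<^sup>2 * K * r\<^sup>2 / p"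
    then have "d \<le> \<beta> * (r / p) * p" using p by simp
    also have "\<dots> \<le> \<beta> * (r / p) * M"
      using pM beta r p by (intro mult_left_mono) auto
    finally show ?thesis .
  qed
  also have "\<dots> \<le> \<beta> * (\<beta> ^ k * (N (v 1 - v 0) / p1)) * M"
    using ratio_bound[of k] beta p pM
    by (intro mult_right_mono mult_left_mono) (auto simp: r_def p_def p1_def)
  also have "\<dots> \<le> \<beta> * (\<beta> ^ k * ((1 + Q (real (\<tau> 1))) * dist_opt (v 0) / p1)) * M"
    using step_bound[of "v 0" "\<tau> 1"] v_step[of 1] v0 tau beta p1 p pM
    by (intro mult_right_mono mult_left_mono divide_right_mono) auto
  also have "\<dots> = \<beta> ^ Suc k * ((1 + Q (real (\<tau> 1))) * (M / p1)) * dist_opt (v 0)"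
    by simp
  also have "M / p1 = max 1 (\<phi> tstar / p1)"
    using p1 by (simp add: M_def max_def field_simps)
  finally show ?thesis by (simp only: d_def p1_def)
qed

lemma distance_contraction:
  assumes eps: "0 < \<epsilon>" "\<epsilon> < 1"
    and n: "n = nat \<lceil>log (1 / \<beta>)
      ((1 + Q (real (\<tau> 1))) / \<epsilon> * max 1 (\<phi> tstar / \<phi> (real (\<tau> 1))))\<rceil>"
  shows "dist_opt (v n) \<le> \<epsilon> * dist_opt (v 0)"
proof -
  define A where "A = (1 + Q (real (\<tau> 1))) * max 1 (\<phi> tstar / \<phi> (real (\<tau> 1)))"
  have "1 * 1 < (1 + Q (real (\<tau> 1))) * max 1 (\<phi> tstar / \<phi> (real (\<tau> 1)))"
    using Q_pos[of "real (\<tau> 1)"] by (intro mult_less_le_imp_less) auto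
  then have A: "A > 1" by (simp add: A_def)
  then have A': "A / \<epsilon> > 1" using eps by (simp add: less_divide_eq)
  have n': "n = nat \<lceil>log (1 / \<beta>) (A / \<epsilon>)\<rceil>" unfolding n A_def by (simp add: mult.commute)
  \<comment> \<open>Positivity makes \<open>n\<close> at least 1, as \<open>distance_bound\<close>
    needs, and truncation by \<open>nat\<close> harmless.\<close>
  have "log (1 / \<beta>) (A / \<epsilon>) > 0" using beta A' by (subst zero_less_log_cancel_iff) auto
  then obtain k where k: "n = Suc k" unfolding n' by (cases "nat \<lceil>log (1 / \<beta>) (A / \<epsilon>)\<rceil>") auto
  have "log (1 / \<beta>) (A / \<epsilon>) \<le> real n" unfolding n' by (rule real_nat_ceiling_ge)
  then have "A / \<epsilon> \<le> (1 / \<beta>) powr real n" using beta A' by (subst (asm) log_le_iff) auto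
  then have "\<beta> ^ n * A \<le> \<epsilon>"
    using beta eps by (simp add: powr_realpow power_one_over field_simps)
  moreover have "dist_opt (v n) \<le> \<beta> ^ n * A * dist_opt (v 0)"
    using distance_bound[of k] by (simp only: k A_def)
  ultimately show ?thesis
    using set_distance_nonneg[OF norm nonempty, of "v 0"] by (meson mult_right_mono order_trans)
qed

text \<open>This certifies that no epoch length is the unspecified value of an empty
  \<open>LEAST\<close>.\<close>

lemma restart_test_eventually_passes:
  assumes "i \<ge> 2"
  shows "\<exists>t\<ge>1. restart_test N \<beta> \<phi> w (v (i - 2)) (\<tau> (i - 1)) (v (i - 1)) t"
proof -
  obtain j where "i = Suc (Suc j)" using assms by (metis Suc_le_D numeral_2_eq_2 Suc_le_mono)
  then show ?thesis using restart_test_at_stop[of j] epoch_valid[of "Suc j"] by auto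
qed

end

section \<open>The result for the localized duality gap\<close>

text \<open>The first conjunct states that the scheme is well defined. Requiring
  \<open>tstar - 2\<close> in the domain of \<open>\<phi>\<close> makes \<open>tstar > 2\<close>.
  The hypothesis \<open>no_stall\<close> excludes an epoch that returns its non-optimal starting
  point: there (ii) bounds only the gap at radius 0, which is trivially 0.\<close>

theorem theorem1:
  fixes X :: "(real ^ 'p) set" and Y :: "(real ^ 'm) set"
    and N :: "(real ^ 'p) \<times> (real ^ 'm) \<Rightarrow> real"
    and f :: "(real ^ 'p) \<times> (real ^ 'm) \<Rightarrow> real"
    and init :: "(real ^ 'p) \<times> (real ^ 'm) \<Rightarrow> ((real ^ 'p) \<times> (real ^ 'm)) \<times> 's"
    and step :: "((real ^ 'p) \<times> (real ^ 'm)) \<times> 's \<Rightarrow> ((real ^ 'p) \<times> (real ^ 'm)) \<times> 's"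
    and \<phi> Q :: "real \<Rightarrow> real"
    and \<beta> C \<theta> \<kappa> tstar \<epsilon> :: real
    and v0 :: "(real ^ 'p) \<times> (real ^ 'm)"
    and v :: "nat \<Rightarrow> (real ^ 'p) \<times> (real ^ 'm)" and \<tau> :: "nat \<Rightarrow> nat"
    and n :: nat
  defines "W \<equiv> X \<times> Y"
    and "\<Delta> \<equiv> duality_gap N X Y f"
    and "Wstar \<equiv> optimal_set N X Y f"
    and "w \<equiv> iterate init step"
  assumes "closed X" "convex X" "closed Y" "convex Y"
    and "is_norm N"
    and "Wstar \<noteq> {}"
    and "\<And>u t. u \<in> W \<Longrightarrow> t \<ge> 1 \<Longrightarrow> w t u \<in> W"
    and "0 < \<beta>" "\<beta> < 1"
    and "\<And>s. s > 0 \<Longrightarrow> \<phi> s > 0"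
    and "strict_mono_on {0<..} \<phi>"
    and "concave_on {0<..} (\<lambda>s. ln (\<phi> s))"
    and "\<not> bdd_above (\<phi> ` {0<..})"
    and cond_i: "\<And>u ra rb. u \<in> W \<Longrightarrow> ra > 0 \<Longrightarrow> rb \<ge> 0 \<Longrightarrow>
      \<Delta> rb u \<le> ereal (max 1 (rb / ra)) * \<Delta> ra u"
    and cond_ii: "C > 0" "\<And>u t r. u \<in> W \<Longrightarrow> t \<ge> 1 \<Longrightarrow> r = N (w t u - u) \<Longrightarrow>
      \<Delta> (\<beta> * r) (w t u) \<le> ereal (C * (1 + \<beta>)\<^sup>2 * r\<^sup>2 / \<phi> (real t))"
    and cond_iii: "antimono Q" "\<And>s. Q s > 0"
      "\<And>u t z. u \<in> W \<Longrightarrow> t \<ge> 1 \<Longrightarrow> z \<in> Wstar \<Longrightarrow>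
        N (w t u - z) \<le> Q (real t) * N (u - z)"
    and cond_iv: "\<theta> > 0" "\<And>u r. u \<in> W \<Longrightarrow> r = set_distance N Wstar u \<Longrightarrow>
      ereal (\<theta> * r\<^sup>2) \<le> \<Delta> r u"
    and "\<kappa> = C / \<theta>"
    and "tstar \<ge> 2" "tstar - 2 \<in> {0<..}"
    and "\<phi> (tstar - 2) / (1 + Q (tstar - 2))\<^sup>2 \<ge> (1 + \<beta>)\<^sup>2 / \<beta>\<^sup>2 * \<kappa>"
    and "0 < \<epsilon>" "\<epsilon> < 1"
    and "v0 \<in> W"
    and "adaptive_restart N \<beta> \<phi> w v0 v \<tau>"
    and no_stall: "\<And>i. i \<ge> 1 \<Longrightarrow> v i = v (i - 1) \<Longrightarrow> v (i - 1) \<in> Wstar"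
    and "n = nat \<lceil>log (1 / \<beta>)
      ((1 + Q (real (\<tau> 1))) / \<epsilon> * max 1 (\<phi> tstar / \<phi> (real (\<tau> 1))))\<rceil>"
  shows "(\<forall>i\<ge>2. \<exists>t\<ge>1. restart_test N \<beta> \<phi> w (v (i - 2)) (\<tau> (i - 1)) (v (i - 1)) t) \<and>
    set_distance N Wstar (v n) \<le> \<epsilon> * set_distance N Wstar v0 \<and>
    (\<Sum>i = 1..n. real (\<tau> i)) \<le> tstar * real n + 2 * max (real (\<tau> 1) - tstar) 0"
proof -
  have v0_eq: "v 0 = v0" using \<open>adaptive_restart N \<beta> \<phi> w v0 v \<tau>\<close> by (simp add: adaptive_restart_def)
  interpret restart_scheme N W Wstar \<Delta> w \<phi> Q \<beta> C \<theta> tstar v \<tau>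
  proof unfold_locales
    show "mono_on {0<..} \<phi>" by (rule strict_mono_on_imp_mono_on) fact
    show "2 < tstar" using \<open>tstar - 2 \<in> {0<..}\<close> by simp
    show "v 0 \<in> W" using \<open>v0 \<in> W\<close> v0_eq by simp
    show "adaptive_restart N \<beta> \<phi> w (v 0) v \<tau>"
      using \<open>adaptive_restart N \<beta> \<phi> w v0 v \<tau>\<close> v0_eq by simp
    show "(1 + \<beta>)\<^sup>2 / \<beta>\<^sup>2 * (C / \<theta>) \<le> \<phi> (tstar - 2) / (1 + Q (tstar - 2))\<^sup>2"
      using assms by metis
    show "\<And>u t. u \<in> W \<Longrightarrow> t \<ge> 1 \<Longrightarrow>
      \<Delta> (\<beta> * N (w t u - u)) (w t u) \<le> ereal (C * (1 + \<beta>)\<^sup>2 * (N (w t u - u))\<^sup>2 / \<phi> (real t))"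
      by (rule cond_ii(2)) auto
    show "\<And>u. u \<in> W \<Longrightarrow>
      ereal (\<theta> * (set_distance N Wstar u)\<^sup>2) \<le> \<Delta> (set_distance N Wstar u) u"
      by (rule cond_iv(2)) auto
  qed fact+
  show ?thesis
    using restart_test_eventually_passes distance_contraction[of \<epsilon> n] sum_epochs[of n] v0_eq
      \<open>0 < \<epsilon>\<close> \<open>\<epsilon> < 1\<close> \<open>n = _\<close> by simp
qed

end
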